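(* Let $W$ be a Coxeter group with finite set $S$ of simple reflections, and let $w\in W$. Then $$|C(w)|=\sum_{\substack{\emptyset\neq T\subset D_R(w)\\ T\text{ independent}}}(-1)^{|T|+1}\,|C(wT)|,$$ where in $wT$ the independent set $T$ is regarded as the element $\prod_{s\in T}s$ of $W$.
   Context: Coxeter groups and roots. $W$ is generated by $S$ with relations $s^2=1$ and $(ss')^{m_{ss'}}=1$ for $s\neq s'$, where $m_{ss'}=m_{s's}\in\{2,3,\dots\}\cup\{\infty\}$ is the order of $ss'$ ($m_{ss'}=\infty$ meaning no relation), and $m_{ss}=1$. $\ell(w)$ is the minimal length of a word in $S$ representing $w$. Let $V=\mathbb{R}^S$ with basis $\{r_s\}_{s\in S}$ (simple roots) and symmetric bilinear form $(r_s,r_{s'})=-\cos(\pi/m_{ss'})$, or $-1$ if $m_{ss'}=\infty$. $W$ acts on $V$ by $s r_{s'}=r_{s'}-2(r_s,r_{s'})r_s$, preserving the form. Roots are the vectors $wr_s$ ($w\in W,s\in S$); a root is positive (resp. negative) if all its coefficients in the basis $\{r_s\}$ are $\ge 0$ (resp. $\le 0$), and every root is exactly one of these. $R(w)$ is the set of positive roots $r$ such that $w^{-1}r$ is negative. $D_R(w)=\{s\in S:\ell(ws)<\ell(w)\}$. If $s\notin D_R(w)$ then $R(w)\subset R(ws)$. The sets $C(w)$. For $\lambda:R(w)\to\mathbb{N}_+$ (positive integers) and $s\notin D_R(w)$, define $\lambda'=\Phi(\lambda,s):R(ws)\to\mathbb{N}_+$ by: $\lambda'(r)=\lambda(r)$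 if $r\in R(w)$; if $r\notin R(w)$ and $r$ is simple (i.e. $r=r_t$ for some $t\in S$), then $\lambda'(r)=1$; otherwise, $\lambda'(r)=\lambda(r')+1$, where $r'\in R(w)$ and $\lambda(r')$ is maximal with respect to the property that $(r,r')>0$. Then $C(w)$ is defined recursively: $C(e)$, for $e$ the identity, consists of the empty function only; if $\ell(w)>0$, $C(w)$ contains exactly the functions $\Phi(\lambda,s)$ for $s\in D_R(w)$ and $\lambda\in C(ws)$. A subset $T\subset S$ is independent if all elements of $T$ commute with each other; then the element $\prod_{s\in T}s\in W$ is well defined and is also denoted $T$.
   Formalization: Proved for w ≠ e (at w = e it reads 1 = 0), and with Φ corrected: a new simple root r gets value 1 only if no r' in R(w) has (r,r') > 0, otherwise max+1; with the original rule the formula fails for the longest element of type A_2 (1 versus 2). *)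

theory Defs
  imports
    Complex_Main
    "HOL-Library.Extended_Nat"
    "HOL-Library.FuncSet"
    "HOL-Algebra.Generated_Groups"
    "HOL-Algebra.FiniteProduct"
begin

definition coxeter_matrix :: "'a set \<Rightarrow> ('a \<Rightarrow> 'a \<Rightarrow> enat) \<Rightarrow> bool" where
  "coxeter_matrix S m \<longleftrightarrow>
     (\<forall>s\<in>S. m s s = 1) \<and>
     (\<forall>s\<in>S. \<forall>t\<in>S. s \<noteq> t \<longrightarrow> m s t = m t s \<and> 2 \<le> m s t)"

text \<open>
  Deletion of one relator \<open>(st)\<^sup>m\<close> from a word over \<open>S\<close>; the case \<open>s = t\<close>, where \<open>m s s = 1\<close>,
  is the relator \<open>s\<^sup>2\<close>. Generators are thereby self-inverse, so words without formal inverses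
  suffice, and the generated equivalence relation is equality in the group presented by the
  Coxeter relations.
\<close>

inductive coxeter_step :: "'a set \<Rightarrow> ('a \<Rightarrow> 'a \<Rightarrow> enat) \<Rightarrow> 'a list \<Rightarrow> 'a list \<Rightarrow> bool"
  for S m where
  "\<lbrakk>u \<in> lists S; v \<in> lists S; s \<in> S; t \<in> S; m s t = enat k\<rbrakk>
     \<Longrightarrow> coxeter_step S m (u @ concat (replicate k [s, t]) @ v) (u @ v)"

locale coxeter_system = group G for G (structure) +
  fixes S :: "'a set" and m :: "'a \<Rightarrow> 'a \<Rightarrow> enat"
  assumes S_subset: "S \<subseteq> carrier G"
    and S_generates: "generate G S = carrier G"
    and matrix: "coxeter_matrix S m"
    and presentation:
      "\<And>u v. u \<in> lists S \<Longrightarrow> v \<in> lists S \<Longrightarrow>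
         foldr (\<otimes>) u \<one> = foldr (\<otimes>) v \<one> \<longleftrightarrow> equivclp (coxeter_step S m) u v"
begin

definition word_for :: "'a \<Rightarrow> 'a list \<Rightarrow> bool" where
  "word_for w u \<longleftrightarrow> u \<in> lists S \<and> foldr (\<otimes>) u \<one> = w"

definition len :: "'a \<Rightarrow> nat" where
  "len w = (LEAST n. \<exists>u. word_for w u \<and> length u = n)"

definition D_R :: "'a \<Rightarrow> 'a set" where
  "D_R w = {s \<in> S. len (w \<otimes> s) < len w}"

text \<open>
  Vectors of \<open>V = \<real>\<^sup>S\<close> are coefficient functions; only the coefficients at elements of the
  finite set \<open>S\<close> matter.
\<close>

definition simple_root :: "'a \<Rightarrow> 'a \<Rightarrow> real" where
  "simple_root s = (\<lambda>t. if t = s then 1 else 0)"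

definition gram :: "'a \<Rightarrow> 'a \<Rightarrow> real" where
  "gram s t = (case m s t of enat k \<Rightarrow> - cos (pi / real k) | \<infinity> \<Rightarrow> - 1)"

definition form :: "('a \<Rightarrow> real) \<Rightarrow> ('a \<Rightarrow> real) \<Rightarrow> real" where
  "form x y = (\<Sum>s\<in>S. \<Sum>t\<in>S. x s * y t * gram s t)"

definition reflection :: "'a \<Rightarrow> ('a \<Rightarrow> real) \<Rightarrow> ('a \<Rightarrow> real)" where
  "reflection s x = (\<lambda>t. x t - 2 * form (simple_root s) x * simple_root s t)"

text \<open>The operator is the same for all words representing \<open>w\<close>.\<close>

definition act :: "'a \<Rightarrow> ('a \<Rightarrow> real) \<Rightarrow> ('a \<Rightarrow> real)" where
  "act w = (THE f. \<exists>u. word_for w u \<and> f = foldr reflection u)"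

definition roots :: "('a \<Rightarrow> real) set" where
  "roots = {act w (simple_root s) | w s. w \<in> carrier G \<and> s \<in> S}"

definition pos_roots :: "('a \<Rightarrow> real) set" where
  "pos_roots = {r \<in> roots. \<forall>s\<in>S. 0 \<le> r s}"

definition neg_roots :: "('a \<Rightarrow> real) set" where
  "neg_roots = {r \<in> roots. \<forall>s\<in>S. r s \<le> 0}"

definition R :: "'a \<Rightarrow> ('a \<Rightarrow> real) set" where
  "R w = {r \<in> pos_roots. act (inv w) r \<in> neg_roots}"

text \<open>
  Functions on \<open>R w\<close> are represented as extensional functions, that is, with value
  \<open>undefined\<close> outside \<open>R w\<close>, so that distinct elements of \<open>C w\<close> differ on \<open>R w\<close>.

  The value 1 is given to a new simple root only if it has no positive inner product with a root
  in \<open>R w\<close>. Giving it to every new simple root would identify the functions obtained from the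
  two reduced words of the longest element in type \<open>A\<^sub>2\<close>: both would send the simple roots to 1
  and their sum to 2.
  A new root that is not simple always has positive inner product with some element of \<open>R w\<close>,
  so the maximum below is over a nonempty set.
\<close>

definition Phi :: "'a \<Rightarrow> (('a \<Rightarrow> real) \<Rightarrow> nat) \<Rightarrow> 'a \<Rightarrow> (('a \<Rightarrow> real) \<Rightarrow> nat)" where
  "Phi w l s = (\<lambda>r\<in>R (w \<otimes> s).
     if r \<in> R w then l r
     else if r \<in> simple_root ` S \<and> \<not> (\<exists>r'\<in>R w. 0 < form r r') then 1
     else Max {l r' | r'. r' \<in> R w \<and> 0 < form r r'} + 1)"

text \<open>
  The recursion on length, as a least fixed point; \<open>D_R \<one>\<close> is empty, so the second rule only
  concerns \<open>w \<noteq> \<one>\<close>.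
\<close>

inductive in_C :: "'a \<Rightarrow> (('a \<Rightarrow> real) \<Rightarrow> nat) \<Rightarrow> bool" where
  one: "in_C \<one> (\<lambda>_. undefined)"
| step: "\<lbrakk>w \<in> carrier G; s \<in> D_R w; in_C (w \<otimes> s) l\<rbrakk> \<Longrightarrow> in_C w (Phi (w \<otimes> s) l s)"

definition C :: "'a \<Rightarrow> (('a \<Rightarrow> real) \<Rightarrow> nat) set" where
  "C w = {l. in_C w l}"

definition independent :: "'a set \<Rightarrow> bool" where
  "independent T \<longleftrightarrow> T \<subseteq> S \<and> (\<forall>s\<in>T. \<forall>t\<in>T. s \<otimes> t = t \<otimes> s)"

text \<open>
  \<open>finprod\<close> does not require \<open>G\<close> to be commutative in its definition; it is meaningful as soon
  as the elements of \<open>T\<close> commute with each other.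
\<close>

definition set_elem :: "'a set \<Rightarrow> 'a" where
  "set_elem T = (\<Otimes>s\<in>T. s)"

end

end

theory Submission
  imports Defs
begin

text \<open>
  For \<open>s \<in> D_R w\<close> let \<open>C\<^sub>s\<close> be the set of all \<open>\<Phi>(\<lambda>, s)\<close> with \<open>\<lambda> \<in> C(ws)\<close>, so that \<open>C(w)\<close> is the
  union of the \<open>C\<^sub>s\<close>. Inclusion-exclusion reduces the theorem to showing that the intersection of
  the \<open>C\<^sub>s\<close> over \<open>s \<in> T\<close> is empty if \<open>T\<close> is not independent and is in bijection with \<open>C(wT)\<close>
  otherwise.

  Membership in \<open>C\<^sub>s\<close> is visible in \<open>\<lambda>\<close> itself: call a root \<open>r \<in> R(w)\<close> dominating if
  \<open>\<lambda>(r') < \<lambda>(r)\<close> for all other \<open>r' \<in> R(w)\<close> with \<open>(r, r') > 0\<close>. The root \<open>-w r\<^sub>s\<close> added last by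
  \<open>\<Phi>(\<cdot>, s)\<close> is dominating. If \<open>r\<close> is another dominating root of \<open>R(w)\<close>, then \<open>(r, -w r\<^sub>s) \<le> 0\<close>, as
  otherwise each of the two values would exceed the other; by induction \<open>r = -ws r\<^sub>t\<close> for some
  \<open>t \<in> D_R (ws)\<close>, and \<open>(r, -w r\<^sub>s) = -(r\<^sub>t, r\<^sub>s) \<ge> 0\<close>. So \<open>s\<close> and \<open>t\<close> commute and the last two steps
  \<open>\<Phi>(\<cdot>, t)\<close>, \<open>\<Phi>(\<cdot>, s)\<close> can be interchanged.
\<close>

text \<open>The Chebyshev polynomials of the second kind with index shifted by one.\<close>

fun cheb :: "real \<Rightarrow> nat \<Rightarrow> real" where
  "cheb c 0 = 0"
| "cheb c (Suc 0) = 1"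
| "cheb c (Suc (Suc n)) = 2 * c * cheb c (Suc n) - cheb c n"

text \<open>The recurrence of \<open>cheb\<close> is the identity sin((n+2)x) = 2 cos x sin((n+1)x)
  - sin(nx). The factor sin x avoids a division.\<close>

lemma cheb_cos: "sin x * cheb (cos x) n = sin (real n * x)"
proof (induction "cos x" n rule: cheb.induct)
  case (3 n)
  have "sin (real (Suc (Suc n)) * x) = 2 * cos x * sin (real (Suc n) * x) - sin (real n * x)"
    using sin_add[of "real (Suc n) * x" x] sin_diff[of "real (Suc n) * x" x]
    by (simp add: algebra_simps)
  with 3 show ?case by (simp add: algebra_simps)
qed auto

text \<open>This is the case of infinite order, where \<open>- gram s t\<close> is 1.\<close>

lemma cheb_one: "cheb 1 n = real n"
  by (induction "1::real" n rule: cheb.induct) auto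

lemma sin_pi_div_pos: "2 \<le> k \<Longrightarrow> 0 < sin (pi / real k)"
  by (rule sin_gt_zero) (auto simp: field_simps)

section \<open>Alternating words in two letters\<close>

fun alternating :: "'a \<Rightarrow> 'a \<Rightarrow> nat \<Rightarrow> 'a list" where
  "alternating s t 0 = []"
| "alternating s t (Suc k) = alternating t s k @ [t]"

lemma length_alternating [simp]: "length (alternating s t k) = k"
  by (induction k arbitrary: s t) auto

lemma alternating_in_lists: "s \<in> S \<Longrightarrow> t \<in> S \<Longrightarrow> alternating s t k \<in> lists S"
  by (induction k arbitrary: s t) auto

lemma set_alternating: "set (alternating s t k) \<subseteq> {s, t}"
  by (induction k arbitrary: s t) auto

text \<open>The recursion of \<open>alternating\<close> fixes the last letter, \<open>t\<close>, and
  leaves the first to parity; this is the recursion from the other end.\<close>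

lemma alternating_Suc_Cons: "alternating s t (Suc k) = (if even k then t else s) # alternating s t k"
proof (induction k arbitrary: s t)
  case (Suc k)
  have "alternating s t (Suc (Suc k)) = alternating t s (Suc k) @ [t]" by simp
  also have "\<dots> = (if even k then s else t) # alternating t s k @ [t]"
    by (subst Suc) simp
  finally show ?case by simp
qed auto

lemma alternating_add:
  "alternating s t (j + k) =
    (if even k then alternating s t j else alternating t s j) @ alternating s t k"
  by (induction k arbitrary: s t) auto

lemma concat_replicate_pair: "concat (replicate k [s, t]) = alternating s t (2 * k)"
proof (induction k)
  case (Suc k)
  then show ?case
    using alternating_Suc_Cons[of s t "2*k"] alternating_Suc_Cons[of s t "Suc (2*k)"] by simp
qed auto

text \<open>Finiteness makes the sums in \<open>form\<close> genuine: a sum over an infinite set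
  would be 0.\<close>

locale finite_coxeter_system = coxeter_system +
  assumes finite_S: "finite S"
begin

subsection \<open>Words and length\<close>

abbreviation ev :: "'a list \<Rightarrow> 'a" where
  "ev u \<equiv> foldr (\<otimes>) u \<one>"

lemma S_closed: "s \<in> S \<Longrightarrow> s \<in> carrier G"
  using S_subset by auto

lemma ev_closed: "u \<in> lists S \<Longrightarrow> ev u \<in> carrier G"
  by (induction u) (auto simp: S_closed)

lemma ev_append: "u \<in> lists S \<Longrightarrow> v \<in> lists S \<Longrightarrow> ev (u @ v) = ev u \<otimes> ev v"
  by (induction u) (auto simp: S_closed m_assoc ev_closed)

lemma word_for_append:
  "word_for g u \<Longrightarrow> word_for h v \<Longrightarrow> word_for (g \<otimes> h) (u @ v)"
  unfolding word_for_def by (metis append_in_lists_conv ev_append)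

lemma word_for_S: "s \<in> S \<Longrightarrow> word_for s [s]"
  by (simp add: word_for_def S_closed)

lemma m_self: "s \<in> S \<Longrightarrow> m s s = enat 1"
  using matrix by (auto simp: coxeter_matrix_def one_enat_def)

text \<open>Deleting the relator from the word that consists of it alone is one
  \<open>coxeter_step\<close>, which \<open>presentation\<close> turns into an equation in the
  group.\<close>

lemma ev_relator:
  assumes "s \<in> S" "t \<in> S" "m s t = enat k"
  shows "ev (alternating s t (2 * k)) = \<one>"
proof -
  have "coxeter_step S m ([] @ concat (replicate k [s, t]) @ []) ([] @ [])"
    by (intro coxeter_step.intros assms) auto
  then have "equivclp (coxeter_step S m) (alternating s t (2 * k)) []"
    by (simp add: concat_replicate_pair r_into_equivclp)
  then show ?thesis
    using presentation[OF alternating_in_lists[OF assms(1,2)], of "[]"] by simp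
qed

lemma S_self_mult: "s \<in> S \<Longrightarrow> s \<otimes> s = \<one>"
  using ev_relator[of s s 1] m_self[of s] S_closed[of s]
  by (simp add: numeral_2_eq_2)

lemma inv_S: "s \<in> S \<Longrightarrow> inv s = s"
  using S_self_mult S_closed inv_equality by blast

lemma S_cancel: "w \<in> carrier G \<Longrightarrow> s \<in> S \<Longrightarrow> w \<otimes> s \<otimes> s = w"
  by (simp add: m_assoc S_closed S_self_mult)

lemma ev_rev: "u \<in> lists S \<Longrightarrow> ev (rev u) = inv (ev u)"
proof (induction u)
  case (Cons a u)
  then have a: "a \<in> S" "u \<in> lists S" "rev u \<in> lists S" by auto
  then have "ev (rev (a # u)) = ev (rev u) \<otimes> ev [a]"
    using ev_append[of "rev u" "[a]"] by simp
  also have "\<dots> = inv (ev u) \<otimes> a" using Cons.IH a by (simp add: S_closed)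
  also have "\<dots> = inv (ev (a # u))"
    using a ev_closed[of u] by (simp add: inv_mult_group S_closed inv_S)
  finally show ?case .
qed auto

text \<open>The inverses allowed by \<open>generate\<close> are inverses of generators, which are
  generators themselves.\<close>

lemma ex_word: "w \<in> carrier G \<Longrightarrow> \<exists>u. word_for w u"
proof -
  assume "w \<in> carrier G"
  then have "w \<in> generate G S" by (simp add: S_generates)
  then show ?thesis
  proof induction
    case one
    then show ?case by (auto simp: word_for_def intro: exI[of _ "[]"])
  next
    case (incl h)
    then show ?case by (auto simp: word_for_def S_closed intro!: exI[of _ "[h]"])
  next
    case (inv h)
    then show ?case by (auto simp: word_for_def S_closed inv_S intro!: exI[of _ "[h]"])
  next
    case (eng g h)
    then obtain u v where "word_for g u" "word_for h v" by auto
    then have "word_for (g \<otimes> h) (u @ v)" by (rule word_for_append)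
    then show ?case ..
  qed
qed

lemma len_le: "word_for w u \<Longrightarrow> len w \<le> length u"
  unfolding len_def by (rule Least_le) auto

lemma ex_reduced_word: "w \<in> carrier G \<Longrightarrow> \<exists>u. word_for w u \<and> length u = len w"
  unfolding len_def by (rule LeastI_ex) (use ex_word in auto)

lemma len_ev_le: "u \<in> lists S \<Longrightarrow> len (ev u) \<le> length u"
  by (rule len_le) (simp add: word_for_def)

lemma len_mult_le:
  assumes "g \<in> carrier G" "h \<in> carrier G"
  shows "len (g \<otimes> h) \<le> len g + len h"
proof -
  obtain u v where "word_for g u" "length u = len g" "word_for h v" "length v = len h"
    using ex_reduced_word assms by metis
  then show ?thesis
    using len_le[OF word_for_append, of g u h v] by simp
qed

lemma len_one: "len \<one> = 0"
  using len_le[of \<one> "[]"] by (auto simp: word_for_def)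

text \<open>A step deletes \<open>2 * k\<close> letters. The parity of a word is therefore an
  invariant of the element it represents: the sign character.\<close>

lemma equivclp_even_length:
  "equivclp (coxeter_step S m) u v \<Longrightarrow> even (length u) = even (length v)"
proof (induction rule: equivclp_induct)
  case (step y z)
  then show ?case
    by (auto elim!: coxeter_step.cases simp: concat_replicate_pair)
qed auto

lemma even_length_word:
  assumes "word_for w u" "word_for w v"
  shows "even (length u) = even (length v)"
  using assms presentation[of u v] equivclp_even_length[of u v] by (auto simp: word_for_def)

text \<open>Multiplying by a generator changes the length by at most one, and parity excludes
  equality.\<close>

lemma len_mult_S:
  assumes "w \<in> carrier G" "s \<in> S"
  shows "len (w \<otimes> s) = Suc (len w) \<or> len w = Suc (len (w \<otimes> s))"
proof -
  have ws: "w \<otimes> s \<in> carrier G" using assms by (simp add: S_closed)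
  have s1: "len s \<le> 1" using len_le[of s "[s]"] assms by (auto simp: word_for_def S_closed)
  have a: "len (w \<otimes> s) \<le> len w + 1"
    using len_mult_le[of w s] assms s1 S_closed by fastforce
  have b: "len w \<le> len (w \<otimes> s) + 1"
    using len_mult_le[of "w \<otimes> s" s] assms s1 ws S_cancel S_closed by fastforce
  obtain u where u: "word_for w u" "length u = len w" using ex_reduced_word assms by blast
  obtain v where v: "word_for (w \<otimes> s) v" "length v = len (w \<otimes> s)" using ex_reduced_word ws by blast
  have "word_for (w \<otimes> s) (u @ [s])"
    using u assms by (intro word_for_append word_for_S)
  then have "even (length v) \<noteq> even (length u)" using even_length_word[OF v(1)] by fastforce
  then have "len (w \<otimes> s) \<noteq> len w" using u v by auto
  then show ?thesis using a b by linarith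
qed

lemma D_R_Suc: "w \<in> carrier G \<Longrightarrow> s \<in> D_R w \<Longrightarrow> len w = Suc (len (w \<otimes> s))"
  using len_mult_S[of w s] by (auto simp: D_R_def)

lemma D_R_I: "w \<in> carrier G \<Longrightarrow> s \<in> S \<Longrightarrow> len (w \<otimes> s) \<noteq> Suc (len w) \<Longrightarrow> s \<in> D_R w"
  using len_mult_S[of w s] by (auto simp: D_R_def)

lemma D_R_subset_S: "D_R w \<subseteq> S"
  by (auto simp: D_R_def)

text \<open>The last letter of a reduced word is a descent.\<close>

lemma ex_D_R:
  assumes "w \<in> carrier G" "w \<noteq> \<one>"
  shows "\<exists>s. s \<in> D_R w"
proof -
  obtain u where u: "word_for w u" "length u = len w" using ex_reduced_word assms by blast
  moreover have "u \<noteq> []" using u assms by (auto simp: word_for_def)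
  ultimately obtain v s where us: "u = v @ [s]" by (metis rev_exhaust)
  have v: "v \<in> lists S" "s \<in> S" using u us by (auto simp: word_for_def)
  then have "w = ev v \<otimes> s"
    using u us ev_append[of v "[s]"] by (simp add: word_for_def S_closed)
  then have "w \<otimes> s = ev v" using v ev_closed S_cancel by simp
  then have "len (w \<otimes> s) < len w" using len_ev_le[OF v(1)] u us by simp
  then show ?thesis using v by (auto simp: D_R_def)
qed

subsection \<open>The bilinear form and the geometric representation\<close>

lemma form_lincomb_right:
  "form x (\<lambda>i. a * y i + b * z i) = a * form x y + b * form x z"
  by (simp add: form_def sum_distrib_left sum.distrib[symmetric] algebra_simps)

lemma m_commute: "s \<in> S \<Longrightarrow> t \<in> S \<Longrightarrow> m s t = m t s"
  using matrix by (cases "s = t") (auto simp: coxeter_matrix_def)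

lemma gram_commute: "s \<in> S \<Longrightarrow> t \<in> S \<Longrightarrow> gram s t = gram t s"
  by (simp add: gram_def m_commute)

lemma form_commute: "form x y = form y x"
  unfolding form_def
  by (subst sum.swap) (auto intro!: sum.cong simp: gram_commute)

lemma form_lincomb_left:
  "form (\<lambda>i. a * y i + b * z i) x = a * form y x + b * form z x"
  using form_lincomb_right[of x a y b z] by (simp add: form_commute)

lemma form_simple_root:
  assumes "s \<in> S" "t \<in> S"
  shows "form (simple_root s) (simple_root t) = gram s t"
proof -
  have "form (simple_root s) (simple_root t) =
      (\<Sum>i\<in>S. if i = s then (\<Sum>j\<in>S. if j = t then gram i j else 0) else 0)"
    unfolding form_def simple_root_def by (auto intro!: sum.cong)
  then show ?thesis using assms finite_S by (simp add: sum.delta)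
qed

lemma gram_self: "s \<in> S \<Longrightarrow> gram s s = 1"
  by (simp add: gram_def m_self)

lemma m_ge_2: "s \<in> S \<Longrightarrow> t \<in> S \<Longrightarrow> s \<noteq> t \<Longrightarrow> m s t = enat k \<Longrightarrow> 2 \<le> k"
  using matrix numeral_le_enat_iff[of "num.Bit0 num.One" k]
  by (fastforce simp: coxeter_matrix_def)

lemma gram_finite: "m s t = enat k \<Longrightarrow> gram s t = - cos (pi / real k)"
  by (simp add: gram_def)

lemma gram_nonpos:
  assumes "s \<in> S" "t \<in> S" "s \<noteq> t"
  shows "gram s t \<le> 0"
proof (cases "m s t")
  case (enat k)
  then have "2 \<le> k" using m_ge_2 assms by blast
  then have "pi / real k \<le> pi / 2" "0 \<le> pi / real k" using frac_le[of pi pi 2 "real k"] by auto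
  then have "0 \<le> cos (pi / real k)" 
    by (intro cos_ge_zero) (use pi_gt_zero in linarith)+
  then show ?thesis using enat by (simp add: gram_finite)
qed (simp add: gram_def)

lemma reflection_eq_lincomb:
  "reflection s x = (\<lambda>i. 1 * x i + (- 2 * form (simple_root s) x) * simple_root s i)"
  by (simp add: reflection_def)

lemma reflection_lincomb:
  "reflection s (\<lambda>i. a * y i + b * z i) = (\<lambda>i. a * reflection s y i + b * reflection s z i)"
  by (simp add: reflection_def form_lincomb_right algebra_simps)

lemma reflection_reflection:
  assumes "s \<in> S"
  shows "reflection s (reflection s x) = x"
proof -
  have "form (simple_root s) (reflection s x) = - form (simple_root s) x"
    by (simp only: reflection_eq_lincomb form_lincomb_right form_simple_root gram_self assms)
  then show ?thesis by (simp add: reflection_def fun_eq_iff)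
qed

lemma form_reflection:
  assumes "s \<in> S"
  shows "form (reflection s x) (reflection s y) = form x y"
proof -
  have "form x (simple_root s) = form (simple_root s) x" by (rule form_commute)
  then show ?thesis
    by (simp only: reflection_eq_lincomb form_lincomb_right form_lincomb_left
        form_simple_root gram_self assms) (simp add: algebra_simps)
qed

lemma reflection_simple_root_self: "s \<in> S \<Longrightarrow> reflection s (simple_root s) = (\<lambda>i. - simple_root s i)"
  by (auto simp: reflection_def form_simple_root gram_self)

lemma reflection_plane:
  assumes "s \<in> S" "t \<in> S" "gram s t = - c"
  shows "reflection t (\<lambda>i. a * simple_root s i + b * simple_root t i) =
    (\<lambda>i. a * simple_root s i + (2 * c * a - b) * simple_root t i)"
  using assms gram_commute[of s t]
  by (auto simp: reflection_def form_lincomb_right form_simple_root gram_self algebra_simps)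

text \<open>Each reflection raises the Chebyshev index by one and exchanges the roles of the two
  simple roots.\<close>

lemma alternating_plane:
  assumes "s \<in> S" "t \<in> S" "gram s t = - c"
  shows "foldr reflection (alternating s t k)
      (\<lambda>i. cheb c (Suc j) * simple_root s i + cheb c j * simple_root t i) =
    (if even k then (\<lambda>i. cheb c (Suc (j + k)) * simple_root s i + cheb c (j + k) * simple_root t i)
     else (\<lambda>i. cheb c (j + k) * simple_root s i + cheb c (Suc (j + k)) * simple_root t i))"
  using assms
proof (induction k arbitrary: s t j)
  case (Suc k)
  have r: "reflection t (\<lambda>i. cheb c (Suc j) * simple_root s i + cheb c j * simple_root t i) =
      (\<lambda>i. cheb c (Suc (Suc j)) * simple_root t i + cheb c (Suc j) * simple_root s i)"
    by (subst reflection_plane[OF Suc.prems]) (simp add: add.commute)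
  have "gram t s = - c" using Suc.prems gram_commute by simp
  from Suc.IH[OF Suc.prems(2,1) this, of "Suc j"] show ?case
    by (simp add: r add.commute[of "_ * simple_root t _"] del: cheb.simps)
qed auto

lemma foldr_reflection_lincomb:
  "foldr reflection u (\<lambda>i. a * y i + b * z i) =
    (\<lambda>i. a * foldr reflection u y i + b * foldr reflection u z i)"
  by (induction u) (auto simp: reflection_lincomb)

lemma foldr_reflection_orthogonal:
  "(\<And>s. s \<in> set u \<Longrightarrow> form (simple_root s) x = 0) \<Longrightarrow> foldr reflection u x = x"
  by (induction u) (auto simp: reflection_def)

text \<open>For \<open>s \<noteq> t\<close>, a vector splits into a part in the plane of the two
  simple roots and a part orthogonal to both. The orthogonal part is fixed, and on the plane the
  word shifts the Chebyshev index by \<open>2 * k\<close>, a full period as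
  \<open>c = cos (pi / k)\<close>.\<close>

lemma foldr_reflection_relator:
  assumes "s \<in> S" "t \<in> S" "m s t = enat k"
  shows "foldr reflection (alternating s t (2 * k)) x = x"
proof (cases "s = t")
  case True
  then have "k = 1" using m_self assms by simp
  then show ?thesis using True assms reflection_reflection by (simp add: numeral_2_eq_2)
next
  case False
  define q c where "q = pi / real k" and "c = cos q"
  define W where "W = foldr reflection (alternating s t (2 * k))"
  let ?r = "simple_root s" and ?t = "simple_root t"
  have k: "2 \<le> k" using m_ge_2 assms False by blast
  have sq: "0 < sin q" using sin_pi_div_pos k by (simp add: q_def)
  have gram: "gram s t = - c" "gram t s = - c"
    using assms gram_finite gram_commute by (auto simp: c_def q_def)
  have "cheb c (2 * k + n) = cheb c n" for n
  proof -
    have "real (2 * k + n) * q = real n * q + 2 * pi" using k by (simp add: q_def field_simps)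
    then have "sin q * cheb c (2 * k + n) = sin q * cheb c n"
      unfolding c_def cheb_cos by (simp only: sin_periodic)
    then show ?thesis using sq by simp
  qed
  then have per: "cheb c (j + 2 * k) = cheb c j" for j
    by (simp add: add.commute)
  have W: "W (\<lambda>i. cheb c (Suc j) * ?r i + cheb c j * ?t i) =
      (\<lambda>i. cheb c (Suc j) * ?r i + cheb c j * ?t i)" for j
    unfolding W_def alternating_plane[OF assms(1,2) gram(1)]
    using per[of j] per[of "Suc j"] by simp
  have lin: "W (\<lambda>i. a * y i + b * z i) = (\<lambda>i. a * W y i + b * W z i)" for a b y z
    unfolding W_def by (rule foldr_reflection_lincomb)
  have Ws: "W ?r = ?r" using W[of 0] by simp
  \<comment> \<open>As \<open>cheb c 2 = 2 * c\<close>, the root of \<open>t\<close> is a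
    combination of the fixed vectors with indices 0 and 1.\<close>
  have t: "?t = (\<lambda>i. 1 * (cheb c (Suc 1) * ?r i + cheb c 1 * ?t i) + (- 2 * c) * ?r i)" by auto
  have Wt: "W ?t = ?t" by (subst (1 2) t, subst lin, subst W, subst Ws, rule refl)
  \<comment> \<open>\<open>e\<close> is the Gram determinant of the plane and equals the square of
    \<open>sin q\<close>. Cramer's rule gives the coefficients \<open>a\<close>, \<open>b\<close> of
    the orthogonal projection \<open>z\<close> of \<open>x\<close>.\<close>
  define e where "e = 1 - c\<^sup>2"
  have e: "e \<noteq> 0" using sq by (simp add: e_def c_def cos_squared_eq)
  define a b where "a = (form ?r x + c * form ?t x) / e" and "b = (form ?t x + c * form ?r x) / e"
  define z where "z = (\<lambda>i. a * ?r i + b * ?t i)"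
  define y where "y = (\<lambda>i. 1 * x i + (-1) * z i)"
  have ab: "a - c * b = form ?r x" "b - c * a = form ?t x"
    using e by (auto simp: a_def b_def field_simps) (auto simp: e_def power2_eq_square algebra_simps)
  have "form ?r y = 0" "form ?t y = 0"
    unfolding y_def z_def using ab
    by (simp_all only: form_lincomb_right form_simple_root gram gram_self assms)
      (simp_all add: algebra_simps)
  then have Wy: "W y = y"
    unfolding W_def using set_alternating by (intro foldr_reflection_orthogonal) fastforce
  have Wz: "W z = z" unfolding z_def by (simp add: lin Ws Wt)
  have "x = (\<lambda>i. 1 * y i + 1 * z i)" by (auto simp: y_def)
  then have "W x = (\<lambda>i. 1 * W y i + 1 * W z i)" using lin by metis
  with Wy Wz \<open>x = _\<close> show ?thesis unfolding W_def by simp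
qed

section \<open>The action of the group on vectors\<close>

lemma equivclp_foldr_reflection:
  "equivclp (coxeter_step S m) u v \<Longrightarrow> foldr reflection u = foldr reflection v"
proof (induction rule: equivclp_induct)
  case (step y z)
  have "foldr reflection y = foldr reflection z" if "coxeter_step S m y z" for y z
    using that
    by cases (auto simp: concat_replicate_pair foldr_reflection_relator fun_eq_iff)
  with step show ?case by metis
qed auto

text \<open>Words for the same element are linked by relators, so the description in
  \<open>act\<close> denotes one operator and any word may be used to compute it.\<close>

lemma act_word:
  assumes "word_for w u"
  shows "act w = foldr reflection u"
  unfolding act_def
proof (rule the_equality)
  fix f assume "\<exists>v. word_for w v \<and> f = foldr reflection v"
  then show "f = foldr reflection u"
    using assms presentation equivclp_foldr_reflection by (metis word_for_def)
qed (use assms in auto)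

lemma act_one: "act \<one> x = x"
  using act_word[of \<one> "[]"] by (simp add: word_for_def)

lemma act_S: "s \<in> S \<Longrightarrow> act s = reflection s"
  using act_word[of s "[s]"] by (auto simp: word_for_def S_closed)

lemma act_mult:
  assumes "g \<in> carrier G" "h \<in> carrier G"
  shows "act (g \<otimes> h) x = act g (act h x)"
proof -
  obtain u v where uv: "word_for g u" "word_for h v" using ex_word assms by blast
  then have "word_for (g \<otimes> h) (u @ v)" by (rule word_for_append)
  then show ?thesis using uv by (simp add: act_word)
qed

lemma act_inv: "w \<in> carrier G \<Longrightarrow> act (inv w) (act w x) = x" "w \<in> carrier G \<Longrightarrow> act w (act (inv w) x) = x"
  by (simp_all add: act_mult[symmetric] act_one)

lemma act_lincomb:
  "w \<in> carrier G \<Longrightarrow> act w (\<lambda>i. a * y i + b * z i) = (\<lambda>i. a * act w y i + b * act w z i)"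
  using ex_word[of w] by (auto simp: act_word foldr_reflection_lincomb)

lemma act_uminus: "w \<in> carrier G \<Longrightarrow> act w (\<lambda>i. - y i) = (\<lambda>i. - act w y i)"
  using act_lincomb[of w "-1" y 0 y] by simp

lemma form_act:
  assumes "w \<in> carrier G"
  shows "form (act w x) (act w y) = form x y"
proof -
  obtain u where u: "word_for w u" using ex_word assms by blast
  have "u \<in> lists S \<Longrightarrow> form (foldr reflection u x) (foldr reflection u y) = form x y"
    by (induction u) (auto simp: form_reflection)
  then show ?thesis using act_word[OF u] u by (simp add: word_for_def)
qed

lemma act_outside_S:
  assumes "w \<in> carrier G" "i \<notin> S"
  shows "act w x i = x i"
proof -
  obtain u where u: "word_for w u" using ex_word assms by blast
  have "u \<in> lists S \<Longrightarrow> foldr reflection u x i = x i"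
    using assms(2) by (induction u) (auto simp: reflection_def simple_root_def)
  then show ?thesis using act_word[OF u] u by (simp add: word_for_def)
qed

subsection \<open>Positive and negative roots\<close>

text \<open>If the order is a finite \<open>n\<close>, the value is sin(k pi/n) / sin(pi/n), and
  \<open>k \<le> n\<close> keeps the numerator nonnegative. For infinite order the value is
  \<open>k\<close>.\<close>

lemma cheb_nonneg:
  assumes "s \<in> S" "t \<in> S" "s \<noteq> t" "\<And>n. m s t = enat n \<Longrightarrow> k \<le> n"
  shows "0 \<le> cheb (- gram s t) k"
proof (cases "m s t")
  case (enat n)
  then have n: "2 \<le> n" "k \<le> n" using m_ge_2 assms by auto
  then have "real k * (pi / real n) \<le> pi" by (simp add: field_simps)
  then have "0 \<le> sin (real k * (pi / real n))" by (intro sin_ge_zero) auto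
  then show ?thesis
    using cheb_cos[of "pi / real n" k] sin_pi_div_pos[OF n(1)] gram_finite[OF enat]
    by (metis minus_minus zero_le_mult_iff less_le_not_le)
next
  case infinity
  then show ?thesis by (simp add: gram_def cheb_one)
qed

text \<open>Write \<open>w = v a\<close> with \<open>a\<close> an alternating word in \<open>s\<close> and a descent \<open>t\<close> of \<open>w\<close>, as long as
  possible subject to \<open>\<ell>(w) = \<ell>(v) + \<ell>(a)\<close>. Then neither \<open>s\<close> nor \<open>t\<close> is a descent of \<open>v\<close>, and \<open>a\<close>
  maps the simple root of \<open>s\<close> to a nonnegative combination of the simple roots of \<open>s\<close> and \<open>t\<close>.\<close>

lemma act_simple_root_nonneg:
  assumes "w \<in> carrier G" "s \<in> S" "len (w \<otimes> s) = Suc (len w)"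
  shows "0 \<le> act w (simple_root s) i"
  using assms
proof (induction "len w" arbitrary: w s rule: less_induct)
  case less
  show ?case
  proof (cases "w = \<one>")
    case True
    then show ?thesis by (simp add: act_one simple_root_def)
  next
    case False
    then obtain t where t: "t \<in> D_R w" using ex_D_R less.prems by blast
    then have tS: "t \<in> S" and ts: "s \<noteq> t" using less.prems by (auto simp: D_R_def)
    note sS = less.prems(2) and w = less.prems(1)
    let ?a = "\<lambda>k. ev (alternating s t k)"
    have aS: "alternating s t k \<in> lists S" "alternating t s k \<in> lists S" for k
      by (rule alternating_in_lists; rule sS tS)+
    have ac: "?a k \<in> carrier G" for k using ev_closed aS by blast
    define P where "P k \<longleftrightarrow> (\<exists>v\<in>carrier G. w = v \<otimes> ?a k \<and> len w = len v + k)" for k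
    have "P 1" unfolding P_def
      using w t tS S_closed S_cancel D_R_Suc by (auto intro!: bexI[of _ "w \<otimes> t"])
    moreover have bd: "k \<le> len w" if "P k" for k using that by (auto simp: P_def)
    ultimately obtain k where k: "P k" "\<And>j. P j \<Longrightarrow> j \<le> k" "1 \<le> k"
      using GreatestI_nat[of P 1 "len w"] Greatest_le_nat[of P _ "len w"] by metis
    then obtain v where v: "v \<in> carrier G" "w = v \<otimes> ?a k" "len w = len v + k"
      by (auto simp: P_def)
    obtain j where j: "k = Suc j" using k(3) by (cases k) auto
    \<comment> \<open>If \<open>y\<close> were a descent of \<open>v\<close>, it would either cancel
      the first letter of the alternating word, making \<open>w\<close> too short, or prolong that
      word, contrary to the maximality of \<open>k\<close>.\<close>
    have up: "len (v \<otimes> y) = Suc (len v)" if y: "y \<in> {s, t}" for y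
    proof (rule ccontr)
      assume "\<not> ?thesis"
      moreover have yS: "y \<in> S" using y sS tS by auto
      ultimately have lv: "len v = Suc (len (v \<otimes> y))" using D_R_I D_R_Suc v(1) by blast
      have vy: "v \<otimes> y \<in> carrier G" using v(1) yS S_closed by simp
      show False
      proof (cases "y = (if even j then t else s)")
        case True
        then have "?a k = y \<otimes> ?a j" using alternating_Suc_Cons[of s t j] j by simp
        then have "w = v \<otimes> y \<otimes> ?a j" using v yS S_closed ac by (simp add: m_assoc)
        then have "len w \<le> len (v \<otimes> y) + len (?a j)" using len_mult_le vy ac by simp
        also have "\<dots> \<le> len (v \<otimes> y) + j" using len_ev_le[OF aS(1), of j] by simp
        finally show False using lv v(3) j by simp
      next
        case False
        then have "y = (if even k then t else s)" using y j by auto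
        then have "?a (Suc k) = y \<otimes> ?a k"
          by (simp only: alternating_Suc_Cons foldr.simps comp_apply)
        then have "v \<otimes> y \<otimes> ?a (Suc k) = v \<otimes> (y \<otimes> (y \<otimes> ?a k))"
          using v(1) ac yS S_closed by (simp add: m_assoc)
        also have "\<dots> = w"
          using v(1,2) ac yS S_closed by (simp add: m_assoc[symmetric] S_self_mult)
        finally have "P (Suc k)" unfolding P_def using vy lv v(3) by (auto intro!: bexI[of _ "v \<otimes> y"])
        then show False using k(2) by fastforce
      qed
    qed
    have lt: "len v < len w" using v(3) k(3) by simp
    have nonneg: "0 \<le> act v (simple_root s) i" "0 \<le> act v (simple_root t) i"
      using less.hyps[OF lt v(1)] sS tS up by auto
    \<comment> \<open>If \<open>n \<le> k\<close>, the last \<open>n + 1\<close> letters of the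
      alternating word followed by \<open>s\<close> could be replaced by \<open>n - 1\<close>
      letters, using the relator of length \<open>2 * n\<close>; then \<open>w \<otimes> s\<close>
      would be shorter than \<open>w\<close>.\<close>
    have kn: "Suc k \<le> n" if n: "m s t = enat n" for n
    proof (rule ccontr)
      assume "\<not> Suc k \<le> n"
      then have nk: "n \<le> k" by simp
      have n2: "2 \<le> n" using m_ge_2 n sS tS ts by blast
      define z where "z = alternating t s (Suc n)"
      \<comment> \<open>\<open>A\<close> and \<open>B\<close> are what is left of the words of
        length \<open>k + 1\<close> and \<open>2 * n\<close> after cutting off their common end
        \<open>z\<close>.\<close>
      define A B where "A = (if even (Suc n) then alternating t s (k - n) else alternating s t (k - n))"
        and "B = (if even (Suc n) then alternating t s (n - 1) else alternating s t (n - 1))"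
      have "k - n + Suc n = Suc k" "n - 1 + Suc n = 2 * n" using nk n2 by auto
      then have A: "alternating t s (Suc k) = A @ z" and B: "alternating t s (2 * n) = B @ z"
        using alternating_add[of t s "k - n" "Suc n"] alternating_add[of t s "n - 1" "Suc n"]
        by (simp_all only: A_def B_def z_def)
      have AS: "A \<in> lists S" "length A = k - n" and BS: "B \<in> lists S" "length B = n - 1"
        using aS unfolding A_def B_def by (metis length_alternating)+
      have zS: "z \<in> lists S" unfolding z_def by (rule aS)
      have "ev B \<otimes> ev z = \<one>"
        using ev_relator[OF tS sS] n m_commute sS tS ev_append[OF BS(1) zS] B by metis
      then have "ev z = inv (ev B)" using ev_closed BS(1) zS by (metis inv_equality inv_inv inv_closed)
      then have "ev z = ev (rev B)" using ev_rev BS by simp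
      then have lz: "len (ev z) \<le> n - 1" using len_ev_le[of "rev B"] BS in_lists_conv_set by fastforce
      have "w \<otimes> s = v \<otimes> (?a k \<otimes> ev [s])"
        using v(1,2) ac sS S_closed by (simp add: m_assoc)
      also have "?a k \<otimes> ev [s] = ev (alternating s t k @ [s])"
        by (rule ev_append[symmetric]) (use aS sS in auto)
      also have "\<dots> = ev A \<otimes> ev z" using A ev_append[OF AS(1) zS] by simp
      finally have "len (w \<otimes> s) \<le> len v + (len (ev A) + len (ev z))"
        using len_mult_le[of v "ev A \<otimes> ev z"] len_mult_le[of "ev A" "ev z"] v(1) ev_closed AS(1) zS
        by fastforce
      also have "\<dots> \<le> len v + ((k - n) + (n - 1))" using lz len_ev_le[OF AS(1)] AS(2) by simp
      finally show False using less.prems(3) v(3) nk n2 by simp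
    qed
    define c where "c = - gram s t"
    have c: "0 \<le> cheb c k" "0 \<le> cheb c (Suc k)"
      unfolding c_def using sS tS ts kn by (auto intro!: cheb_nonneg dest: Suc_leD)
    have "gram s t = - c" by (simp add: c_def)
    then have alt: "foldr reflection (alternating s t k) (simple_root s) =
      (if even k then (\<lambda>i. cheb c (Suc k) * simple_root s i + cheb c k * simple_root t i)
       else (\<lambda>i. cheb c k * simple_root s i + cheb c (Suc k) * simple_root t i))"
      using alternating_plane[OF sS tS, of c k 0] by simp
    have "act (?a k) = foldr reflection (alternating s t k)"
      by (rule act_word) (use aS in \<open>simp add: word_for_def\<close>)
    then have "act w (simple_root s) = act v (foldr reflection (alternating s t k) (simple_root s))"
      using v ac act_mult by simp
    then show ?thesis
      using c nonneg v(1) by (auto simp: alt act_lincomb simp del: cheb.simps)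
  qed
qed

text \<open>\<open>s\<close> sends its root to the negative, so this is the nonnegativity at
  \<open>w \<otimes> s\<close>, where \<open>s\<close> is an ascent.\<close>

lemma act_simple_root_nonpos:
  assumes "w \<in> carrier G" "s \<in> D_R w"
  shows "act w (simple_root s) i \<le> 0"
proof -
  have s: "s \<in> S" "w \<otimes> s \<in> carrier G" using assms S_closed by (auto simp: D_R_def)
  have "act w (simple_root s) = act (w \<otimes> s \<otimes> s) (simple_root s)"
    using assms s S_cancel by simp
  also have "\<dots> = (\<lambda>i. - act (w \<otimes> s) (simple_root s) i)"
    using s act_mult[OF s(2) S_closed[OF s(1)]]
    by (simp add: act_S reflection_simple_root_self act_uminus)
  finally show ?thesis
    using act_simple_root_nonneg[OF s(2,1), of i] D_R_Suc assms s S_cancel by simp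
qed

lemma simple_root_in_roots: "s \<in> S \<Longrightarrow> simple_root s \<in> roots"
  unfolding roots_def using act_one by (metis (mono_tags, lifting) mem_Collect_eq one_closed)

lemma act_in_roots: "w \<in> carrier G \<Longrightarrow> x \<in> roots \<Longrightarrow> act w x \<in> roots"
  unfolding roots_def using act_mult by (auto, metis m_closed)

lemma uminus_in_roots:
  assumes "x \<in> roots"
  shows "(\<lambda>i. - x i) \<in> roots"
proof -
  obtain w s where ws: "w \<in> carrier G" "s \<in> S" "x = act w (simple_root s)"
    using assms by (auto simp: roots_def)
  then have "(\<lambda>i. - x i) = act w (act s (simple_root s))"
    by (simp add: act_S reflection_simple_root_self act_uminus)
  then show ?thesis using ws act_in_roots simple_root_in_roots S_closed by metis
qed

lemma form_root_self: "x \<in> roots \<Longrightarrow> form x x = 1"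
  by (auto simp: roots_def form_act form_simple_root gram_self)

text \<open>Vectors are functions on the whole type; knowing the coefficients outside
  \<open>S\<close> allows roots to be compared as functions.\<close>

lemma root_outside_S: "x \<in> roots \<Longrightarrow> i \<notin> S \<Longrightarrow> x i = 0"
  by (auto simp: roots_def act_outside_S simple_root_def)

text \<open>A root of both signs would vanish on \<open>S\<close>, against
  \<open>form x x = 1\<close>. The image of the root of \<open>s\<close> under \<open>w\<close> has
  a sign because \<open>s\<close> is either a descent or an ascent of \<open>w\<close>.\<close>

lemma neg_roots_iff:
  assumes "x \<in> roots"
  shows "x \<in> neg_roots \<longleftrightarrow> x \<notin> pos_roots"
proof
  assume "x \<in> neg_roots"
  show "x \<notin> pos_roots"
  proof
    assume "x \<in> pos_roots"
    then have "\<forall>s\<in>S. x s = 0" using \<open>x \<in> neg_roots\<close> by (force simp: pos_roots_def neg_roots_def)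
    then have "form x x = 0" by (simp add: form_def)
    then show False using form_root_self assms by simp
  qed
next
  obtain w s where ws: "w \<in> carrier G" "s \<in> S" "x = act w (simple_root s)"
    using assms by (auto simp: roots_def)
  assume "x \<notin> pos_roots"
  then have "s \<in> D_R w"
    using ws D_R_I act_simple_root_nonneg assms by (fastforce simp: pos_roots_def)
  then show "x \<in> neg_roots" using ws act_simple_root_nonpos assms by (auto simp: neg_roots_def)
qed

lemma pos_roots_subset: "pos_roots \<subseteq> roots" and neg_roots_subset: "neg_roots \<subseteq> roots"
  by (auto simp: pos_roots_def neg_roots_def)

lemma D_R_iff_neg:
  assumes "w \<in> carrier G" "s \<in> S"
  shows "s \<in> D_R w \<longleftrightarrow> act w (simple_root s) \<in> neg_roots"
proof -
  have r: "act w (simple_root s) \<in> roots" using assms act_in_roots simple_root_in_roots by blast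
  show ?thesis
  proof
    assume "s \<in> D_R w"
    then show "act w (simple_root s) \<in> neg_roots"
      using act_simple_root_nonpos r assms by (auto simp: neg_roots_def)
  next
    assume "act w (simple_root s) \<in> neg_roots"
    then have "act w (simple_root s) \<notin> pos_roots" using neg_roots_iff r by blast
    then show "s \<in> D_R w"
      using D_R_I act_simple_root_nonneg r assms by (fastforce simp: pos_roots_def)
  qed
qed

lemma simple_root_pos: "s \<in> S \<Longrightarrow> simple_root s \<in> pos_roots"
  using simple_root_in_roots by (auto simp: pos_roots_def simple_root_def)

lemma uminus_neg_roots: "x \<in> neg_roots \<Longrightarrow> (\<lambda>i. - x i) \<in> pos_roots"
  using uminus_in_roots by (auto simp: pos_roots_def neg_roots_def)

lemma uminus_pos_roots: "x \<in> pos_roots \<Longrightarrow> (\<lambda>i. - x i) \<in> neg_roots"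
  using uminus_in_roots by (auto simp: pos_roots_def neg_roots_def)

text \<open>Only the coefficient at \<open>s\<close> changes. Another coefficient is positive, since
  a nonnegative multiple of the root of \<open>s\<close> with norm 1 is that root itself.\<close>

lemma reflection_pos_root:
  assumes "s \<in> S" "x \<in> pos_roots" "x \<noteq> simple_root s"
  shows "reflection s x \<in> pos_roots"
proof -
  have x: "x \<in> roots" "\<And>i. i \<in> S \<Longrightarrow> 0 \<le> x i" using assms by (auto simp: pos_roots_def)
  have "\<exists>i\<in>S. i \<noteq> s \<and> x i \<noteq> 0"
  proof (rule ccontr)
    assume "\<not> ?thesis"
    then have "x i = x s * simple_root s i" for i
      using root_outside_S[OF x(1), of i] by (cases "i = s") (auto simp: simple_root_def)
    then obtain a where eq: "x = (\<lambda>i. a * simple_root s i + 0 * simple_root s i)" by auto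
    have "form x x = a * a"
      unfolding eq form_lincomb_right form_lincomb_left by (simp add: form_simple_root gram_self assms)
    then have "a * a = 1" using form_root_self x(1) by simp
    moreover have "0 \<le> a" using x(2)[OF assms(1)] by (simp add: eq simple_root_def)
    ultimately have "a = 1" by (simp add: square_eq_1_iff)
    then show False using eq assms(3) by simp
  qed
  then obtain i where i: "i \<in> S" "i \<noteq> s" "0 < x i" using x(2) by (metis less_eq_real_def)
  then have "reflection s x i > 0" by (simp add: reflection_def simple_root_def)
  then have "reflection s x \<notin> neg_roots" using i by (force simp: neg_roots_def)
  moreover have "reflection s x \<in> roots"
    using act_in_roots[OF S_closed[OF assms(1)] x(1)] assms by (simp add: act_S)
  ultimately show ?thesis using neg_roots_iff by blast
qed

section \<open>Inversion sets under right multiplication\<close>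

lemma reflection_neg_roots_iff:
  assumes "s \<in> S" "x \<in> roots" "x \<noteq> simple_root s" "x \<noteq> (\<lambda>i. - simple_root s i)"
  shows "reflection s x \<in> neg_roots \<longleftrightarrow> x \<in> neg_roots"
proof -
  have r: "reflection s x \<in> roots"
    using act_in_roots[OF S_closed[OF assms(1)] assms(2)] assms(1) by (simp add: act_S)
  show ?thesis
  proof (cases "x \<in> neg_roots")
    case True
    have "(\<lambda>i. - x i) \<noteq> simple_root s" using assms(4) by (metis minus_minus)
    then have "reflection s (\<lambda>i. - x i) \<in> pos_roots"
      using reflection_pos_root assms(1) uminus_neg_roots[OF True] by blast
    moreover have "reflection s (\<lambda>i. - x i) = (\<lambda>i. - reflection s x i)"
      using reflection_lincomb[of s "-1" x 0 x] by simp
    ultimately have "reflection s x \<in> neg_roots" using uminus_pos_roots by fastforce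
    then show ?thesis using True by simp
  next
    case False
    then show ?thesis using reflection_pos_root neg_roots_iff assms r by blast
  qed
qed

text \<open>Let \<open>y\<close> be the image of a positive root \<open>x\<close> under
  \<open>inv w\<close>. The reflection in \<open>s\<close> changes the sign of \<open>y\<close> only
  if \<open>y\<close> is plus or minus the root of \<open>s\<close>. Plus gives the new root; minus
  would make \<open>x\<close> negative.\<close>

lemma R_mult:
  assumes w: "w \<in> carrier G" and s: "s \<in> S" and len: "len (w \<otimes> s) = Suc (len w)"
  shows "R (w \<otimes> s) = insert (act w (simple_root s)) (R w)"
    and "act w (simple_root s) \<notin> R w"
proof -
  let ?b = "act w (simple_root s)"
  have b: "?b \<in> pos_roots"
    using act_simple_root_nonneg[OF assms] act_in_roots[OF w simple_root_in_roots[OF s]]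
    by (auto simp: pos_roots_def)
  have inv: "act (inv (w \<otimes> s)) x = reflection s (act (inv w) x)" for x
    using w s by (simp add: inv_mult_group S_closed inv_S act_mult act_S)
  have sneg: "simple_root s \<notin> neg_roots"
    using simple_root_pos s neg_roots_iff pos_roots_subset by blast
  then show "?b \<notin> R w" using act_inv w by (simp add: R_def)
  have "x \<in> R (w \<otimes> s) \<longleftrightarrow> x = ?b \<or> x \<in> R w" if x: "x \<in> pos_roots" for x
  proof -
    let ?y = "act (inv w) x"
    have wy: "act w ?y = x" using act_inv w by simp
    have y: "?y \<in> roots" using act_in_roots w x pos_roots_subset by auto
    show ?thesis
    proof (cases "?y = simple_root s")
      case True
      then have "x = ?b" using wy by simp
      moreover have "reflection s (simple_root s) \<in> neg_roots"
        using s reflection_simple_root_self uminus_pos_roots simple_root_pos by simp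
      ultimately show ?thesis using x True inv by (simp add: R_def)
    next
      case False
      have "?y \<noteq> (\<lambda>i. - simple_root s i)"
      proof
        assume "?y = (\<lambda>i. - simple_root s i)"
        then have "x = (\<lambda>i. - ?b i)" using wy act_uminus w by metis
        then have "x \<in> neg_roots" using uminus_pos_roots b by simp
        then show False using x neg_roots_iff pos_roots_subset by blast
      qed
      then have "x \<in> R (w \<otimes> s) \<longleftrightarrow> x \<in> R w"
        using reflection_neg_roots_iff[OF s y False] inv x by (simp add: R_def)
      moreover have "x \<noteq> ?b" using False act_inv w by auto
      ultimately show ?thesis by simp
    qed
  qed
  then show "R (w \<otimes> s) = insert ?b (R w)" using b by (auto simp: R_def)
qed

lemma R_one: "R \<one> = {}"
  using neg_roots_iff pos_roots_subset by (auto simp: R_def act_one)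

lemma act_descent_simple_root:
  assumes "w \<in> carrier G" "s \<in> S"
  shows "act (w \<otimes> s) (simple_root s) = (\<lambda>i. - act w (simple_root s) i)"
  using assms by (simp add: act_mult S_closed act_S reflection_simple_root_self act_uminus)

lemma R_descent:
  assumes "w \<in> carrier G" "s \<in> D_R w"
  shows "R w = insert (act (w \<otimes> s) (simple_root s)) (R (w \<otimes> s))"
    and "act (w \<otimes> s) (simple_root s) \<notin> R (w \<otimes> s)"
proof -
  have s: "s \<in> S" "w \<otimes> s \<in> carrier G" using assms S_closed by (auto simp: D_R_def)
  have "len (w \<otimes> s \<otimes> s) = Suc (len (w \<otimes> s))" using S_cancel D_R_Suc assms s by simp
  from R_mult[OF s(2,1) this] show "R w = insert (act (w \<otimes> s) (simple_root s)) (R (w \<otimes> s))"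
    and "act (w \<otimes> s) (simple_root s) \<notin> R (w \<otimes> s)"
    using S_cancel assms s by auto
qed

text \<open>Induction on the length, in the shape of the recursion for \<open>C\<close>.\<close>

lemma descent_induct [consumes 1, case_names one descent]:
  assumes "w \<in> carrier G"
    and "P \<one>"
    and "\<And>w. w \<in> carrier G \<Longrightarrow> w \<noteq> \<one> \<Longrightarrow> (\<And>s. s \<in> D_R w \<Longrightarrow> P (w \<otimes> s)) \<Longrightarrow> P w"
  shows "P w"
  using assms(1)
proof (induction "len w" arbitrary: w rule: less_induct)
  case less
  show ?case
  proof (cases "w = \<one>")
    case False
    then show ?thesis
      using less assms(3)[of w] S_closed by (auto simp: D_R_def)
  qed (use assms(2) in simp)
qed

lemma finite_R: "w \<in> carrier G \<Longrightarrow> finite (R w)"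
proof (induction rule: descent_induct)
  case (descent w)
  then show ?case using ex_D_R R_descent(1) by (metis finite.insertI)
qed (simp add: R_one)

text \<open>A zero entry forces \<open>m s t = 2\<close>, as \<open>cos (pi / k) > 0\<close> for
  \<open>k > 2\<close>, and then \<open>s \<otimes> t\<close> is its own inverse. Conversely, the
  images of the root of \<open>s\<close> under \<open>t \<otimes> s\<close> and
  \<open>s \<otimes> t\<close> have coefficients \<open>2 * gram s t\<close> and
  \<open>- 2 * gram s t\<close> at \<open>t\<close>.\<close>

lemma gram_eq_0_iff:
  assumes "s \<in> S" "t \<in> S" "s \<noteq> t"
  shows "gram s t = 0 \<longleftrightarrow> s \<otimes> t = t \<otimes> s"
proof
  assume 0: "gram s t = 0"
  obtain k where k: "m s t = enat k"
    using 0 by (cases "m s t") (auto simp: gram_def)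
  have k2: "2 \<le> k" using m_ge_2 assms k by blast
  have "k = 2"
  proof (rule ccontr)
    assume "k \<noteq> 2"
    then have "pi / real k < pi / 2" using k2 by (intro divide_strict_left_mono) auto
    moreover have "0 < pi / real k" using k2 by simp
    ultimately have "0 < cos (pi / real k)" by (intro cos_gt_zero)
    then show False using 0 gram_finite k by simp
  qed
  then have "ev (alternating s t 4) = \<one>" using ev_relator assms k by fastforce
  then have "s \<otimes> (t \<otimes> (s \<otimes> t)) = \<one>"
    using assms S_closed by (simp add: eval_nat_numeral)
  then have "(s \<otimes> t) \<otimes> (s \<otimes> t) = \<one>" using assms S_closed by (simp add: m_assoc)
  then have "s \<otimes> t = inv (s \<otimes> t)" using assms S_closed by (metis inv_equality m_closed)
  then show "s \<otimes> t = t \<otimes> s" using assms by (simp add: inv_mult_group S_closed inv_S)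
next
  assume c: "s \<otimes> t = t \<otimes> s"
  have g: "gram t s = gram s t" using assms gram_commute by simp
  have "form (simple_root t) (\<lambda>i. - simple_root s i) = - gram s t"
    using form_lincomb_right[of "simple_root t" "-1" "simple_root s" 0 "simple_root s"] assms g
    by (simp add: form_simple_root)
  then have "act (t \<otimes> s) (simple_root s) t = 2 * gram s t"
    using assms by (simp add: act_mult S_closed act_S reflection_simple_root_self)
      (simp add: reflection_def simple_root_def)
  moreover have "simple_root t t = 1" "simple_root s t = 0"
    using assms by (simp_all add: simple_root_def)
  then have "act (s \<otimes> t) (simple_root s) t = - 2 * gram s t"
    using assms g by (simp add: act_mult S_closed act_S)
      (simp add: reflection_def form_simple_root)
  ultimately show "gram s t = 0" using c by simp
qed

subsection \<open>The functions in \<open>C w\<close>\<close>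

text \<open>The value \<open>Phi\<close> gives to a new root, with an arbitrary set in place of
  \<open>R w\<close>; this allows a comparison for two sets that differ by one root.\<close>

definition new_value :: "('a \<Rightarrow> real) set \<Rightarrow> (('a \<Rightarrow> real) \<Rightarrow> nat) \<Rightarrow> ('a \<Rightarrow> real) \<Rightarrow> nat" where
  "new_value A l r =
    (if r \<in> simple_root ` S \<and> \<not> (\<exists>r'\<in>A. 0 < form r r') then 1
     else Max {l r' | r'. r' \<in> A \<and> 0 < form r r'} + 1)"

text \<open>A root \<open>r'\<close> with \<open>0 < form r r'\<close> excludes the value 1, even
  for simple \<open>r\<close>, and then the maximum bounds \<open>l r'\<close>. This is why the root
  added last is dominating.\<close>

lemma new_value_greater:
  assumes "finite A" "r' \<in> A" "0 < form r r'"
  shows "l r' < new_value A l r"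
proof -
  have "l r' \<le> Max {l r' | r'. r' \<in> A \<and> 0 < form r r'}"
    using assms by (intro Max_ge) auto
  then show ?thesis using assms by (auto simp: new_value_def)
qed

text \<open>A root orthogonal to \<open>r\<close> does not enter the maximum. This is what makes
  commuting steps independent of each other.\<close>

lemma new_value_cong:
  assumes "\<And>x. x \<in> A \<Longrightarrow> l x = l' x" "form r b = 0"
  shows "new_value (insert b A) l r = new_value A l' r"
proof -
  have "{l r' | r'. r' \<in> insert b A \<and> 0 < form r r'} = {l' r' | r'. r' \<in> A \<and> 0 < form r r'}"
    using assms by force
  then show ?thesis unfolding new_value_def using assms(2) by auto
qed

section \<open>The root added in the last step\<close>

definition last_root :: "'a \<Rightarrow> 'a \<Rightarrow> ('a \<Rightarrow> real)" where
  "last_root w s = act (w \<otimes> s) (simple_root s)"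

lemmas R_last_root = R_descent[folded last_root_def]

lemma last_root_eq:
  "w \<in> carrier G \<Longrightarrow> s \<in> S \<Longrightarrow> last_root w s = (\<lambda>i. - act w (simple_root s) i)"
  by (simp add: last_root_def act_descent_simple_root)

lemma last_root_inject:
  assumes "w \<in> carrier G" "s \<in> S" "t \<in> S" "last_root w s = last_root w t"
  shows "s = t"
proof -
  have "act w (simple_root s) i = act w (simple_root t) i" for i
    using fun_cong[OF assms(4), of i] assms(1-3) by (simp add: last_root_eq)
  then have "act (inv w) (act w (simple_root s)) = act (inv w) (act w (simple_root t))" by presburger
  then have "simple_root s = simple_root t" using act_inv(1) assms(1) by simp
  then have "simple_root s s = simple_root t s" by simp
  then show ?thesis by (simp add: simple_root_def split: if_splits)
qed

lemma descent_closed: "w \<in> carrier G \<Longrightarrow> s \<in> D_R w \<Longrightarrow> w \<otimes> s \<in> carrier G"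
  using S_closed by (auto simp: D_R_def)

lemma Phi_descent:
  assumes "w \<in> carrier G" "s \<in> D_R w"
  shows "Phi (w \<otimes> s) l s =
    (\<lambda>r\<in>R w. if r \<in> R (w \<otimes> s) then l r else new_value (R (w \<otimes> s)) l r)"
  using assms S_cancel[of w s] unfolding Phi_def new_value_def by (simp add: D_R_def)

lemma Phi_old:
  assumes "w \<in> carrier G" "s \<in> D_R w" "r \<in> R (w \<otimes> s)"
  shows "Phi (w \<otimes> s) l s r = l r"
  using assms R_last_root by (simp add: Phi_descent)

lemma Phi_new:
  assumes "w \<in> carrier G" "s \<in> D_R w"
  shows "Phi (w \<otimes> s) l s (last_root w s) = new_value (R (w \<otimes> s)) l (last_root w s)"
  using assms R_last_root by (simp add: Phi_descent)

lemma Phi_extensional: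
  "w \<in> carrier G \<Longrightarrow> s \<in> D_R w \<Longrightarrow> Phi (w \<otimes> s) l s \<in> extensional (R w)"
  by (simp add: Phi_descent)

text \<open>This is the set \<open>C\<^sub>s\<close> of the introduction.\<close>

definition C_last :: "'a \<Rightarrow> 'a \<Rightarrow> (('a \<Rightarrow> real) \<Rightarrow> nat) set" where
  "C_last w s = (\<lambda>l. Phi (w \<otimes> s) l s) ` C (w \<otimes> s)"

lemma D_R_one: "D_R \<one> = {}"
  by (simp add: D_R_def len_one)

lemma C_one: "C \<one> = {\<lambda>_. undefined}"
  by (auto simp: C_def D_R_one intro: in_C.one elim: in_C.cases)

lemma C_last_subset: "w \<in> carrier G \<Longrightarrow> s \<in> D_R w \<Longrightarrow> C_last w s \<subseteq> C w"
  by (auto simp: C_last_def C_def intro: in_C.step)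

lemma C_eq_UN_C_last:
  assumes "w \<in> carrier G" "w \<noteq> \<one>"
  shows "C w = (\<Union>s\<in>D_R w. C_last w s)"
proof
  show "C w \<subseteq> (\<Union>s\<in>D_R w. C_last w s)"
  proof
    fix l assume "l \<in> C w"
    then have "in_C w l" by (simp add: C_def)
    then show "l \<in> (\<Union>s\<in>D_R w. C_last w s)"
    proof cases
      case (step s k)
      then show ?thesis unfolding C_last_def C_def by blast
    qed (use assms in simp)
  qed
qed (use C_last_subset assms in blast)

text \<open>With the value \<open>undefined\<close> outside \<open>R w\<close>, a function in
  \<open>C w\<close> is determined by its values on \<open>R w\<close>.\<close>

lemma C_extensional:
  assumes "w \<in> carrier G"
  shows "C w \<subseteq> extensional (R w)"
proof (cases "w = \<one>")
  case True
  then show ?thesis by (simp add: C_one R_one)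
next
  case False
  then show ?thesis using assms Phi_extensional by (auto simp: C_eq_UN_C_last C_last_def)
qed

lemma finite_C: "w \<in> carrier G \<Longrightarrow> finite (C w)"
proof (induction rule: descent_induct)
  case (descent w)
  have "finite (D_R w)" using D_R_subset_S finite_S finite_subset by blast
  with descent show ?case by (simp add: C_eq_UN_C_last C_last_def)
qed (simp add: C_one)

text \<open>\<open>Phi\<close> keeps the old values, so restricting to
  \<open>R (w \<otimes> s)\<close> recovers the function.\<close>

lemma Phi_inject:
  assumes "w \<in> carrier G" "s \<in> D_R w" "l \<in> C (w \<otimes> s)" "l' \<in> C (w \<otimes> s)"
    and eq: "Phi (w \<otimes> s) l s = Phi (w \<otimes> s) l' s"
  shows "l = l'"
proof (rule extensionalityI[of _ "R (w \<otimes> s)"])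
  show "l \<in> extensional (R (w \<otimes> s))" "l' \<in> extensional (R (w \<otimes> s))"
    using assms C_extensional descent_closed by blast+
  show "l r = l' r" if "r \<in> R (w \<otimes> s)" for r
    using Phi_old[OF assms(1,2) that] eq by metis
qed

lemma C_last_dominates:
  assumes "w \<in> carrier G" "s \<in> D_R w" "l \<in> C_last w s"
    and "r \<in> R w" "r \<noteq> last_root w s" "0 < form (last_root w s) r"
  shows "l r < l (last_root w s)"
proof -
  obtain k where k: "l = Phi (w \<otimes> s) k s" using assms(3) by (auto simp: C_last_def)
  have r: "r \<in> R (w \<otimes> s)" using assms R_last_root by blast
  have "k r < new_value (R (w \<otimes> s)) k (last_root w s)"
    using new_value_greater finite_R[OF descent_closed] assms r by blast
  then show ?thesis using assms r by (simp add: k Phi_old Phi_new)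
qed

section \<open>Interchanging commuting last steps\<close>

lemma commuting_descent:
  assumes "w \<in> carrier G" "s \<in> D_R w" "t \<in> S" "s \<noteq> t" "s \<otimes> t = t \<otimes> s"
  shows "t \<in> D_R (w \<otimes> s) \<longleftrightarrow> t \<in> D_R w"
    and "last_root (w \<otimes> s) t = last_root w t"
proof -
  have s: "s \<in> S" using assms D_R_subset_S by blast
  have "gram s t = 0" using gram_eq_0_iff[of s t] assms(3-5) s by blast
  then have "reflection s (simple_root t) = simple_root t"
    using assms(3) s by (simp add: reflection_def form_simple_root)
  then have "act (w \<otimes> s) (simple_root t) = act w (simple_root t)"
    using assms s by (simp add: act_mult S_closed act_S)
  \<comment> \<open>By \<open>D_R_iff_neg\<close>, both descents are read off the same
    vector.\<close>
  then show "t \<in> D_R (w \<otimes> s) \<longleftrightarrow> t \<in> D_R w" "last_root (w \<otimes> s) t = last_root w t"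
    using assms D_R_iff_neg descent_closed[OF assms(1,2)] by (auto simp: last_root_eq)
qed

text \<open>The roots added by \<open>s\<close> and \<open>t\<close> are orthogonal, so neither
  influences the value of the other, and in both orders the values on
  \<open>R (w \<otimes> s \<otimes> t)\<close> are those of \<open>l\<close>.\<close>

lemma Phi_commute:
  assumes w: "w \<in> carrier G" and s: "s \<in> D_R w" and t: "t \<in> D_R w" and st: "s \<noteq> t"
    and c: "s \<otimes> t = t \<otimes> s"
  shows "Phi (w \<otimes> s) (Phi (w \<otimes> s \<otimes> t) l t) s = Phi (w \<otimes> t) (Phi (w \<otimes> t \<otimes> s) l s) t"
    (is "?L = ?R")
proof -
  define v where "v = w \<otimes> s \<otimes> t"
  have S: "s \<in> S" "t \<in> S" using s t D_R_subset_S by auto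
  have v: "w \<otimes> s \<otimes> t = v" "w \<otimes> t \<otimes> s = v"
    using w S S_closed c by (simp_all add: v_def m_assoc)
  have ws: "w \<otimes> s \<in> carrier G" "w \<otimes> t \<in> carrier G" using w S S_closed by auto
  have ts: "t \<in> D_R (w \<otimes> s)" "s \<in> D_R (w \<otimes> t)"
    "last_root (w \<otimes> s) t = last_root w t" "last_root (w \<otimes> t) s = last_root w s"
    using commuting_descent[of w s t] commuting_descent[of w t s] assms S by auto
  let ?a = "last_root w s" and ?b = "last_root w t"
  have Rs: "R (w \<otimes> s) = insert ?b (R v)" "?b \<notin> R v"
    using R_last_root[OF ws(1) ts(1)] ts v by auto
  have Rt: "R (w \<otimes> t) = insert ?a (R v)" "?a \<notin> R v"
    using R_last_root[OF ws(2) ts(2)] ts v by auto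
  have Rw: "R w = insert ?a (insert ?b (R v))" "?a \<noteq> ?b"
    using R_last_root[OF w s] Rs by auto
  have "form ?a ?b = form (act w (simple_root s)) (act w (simple_root t))"
    using form_lincomb_left[of "-1" "act w (simple_root s)" 0 "act w (simple_root s)"]
      form_lincomb_right[of _ "-1" "act w (simple_root t)" 0 "act w (simple_root t)"]
    by (simp add: last_root_eq w S)
  also have "\<dots> = 0" using gram_eq_0_iff c st S w by (simp add: form_act form_simple_root)
  finally have ab: "form ?a ?b = 0" "form ?b ?a = 0" using form_commute by metis+
  let ?lt = "Phi v l t" and ?ls = "Phi v l s"
  have lt: "?lt r = l r" "?ls r = l r" if "r \<in> R v" for r
    using Phi_old[OF ws(1) ts(1)] Phi_old[OF ws(2) ts(2)] v that by auto
  have new: "?lt ?b = new_value (R v) l ?b" "?ls ?a = new_value (R v) l ?a"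
    using Phi_new[OF ws(1) ts(1), of l] Phi_new[OF ws(2) ts(2), of l] v ts by auto
  have La: "?L ?a = new_value (R v) l ?a"
    using Phi_new[OF w s, of ?lt] new_value_cong[of "R v" ?lt l ?a ?b] lt ab Rs v by simp
  have Rb: "?R ?b = new_value (R v) l ?b"
    using Phi_new[OF w t, of ?ls] new_value_cong[of "R v" ?ls l ?b ?a] lt ab Rt v by simp
  show ?thesis
  proof (rule extensionalityI[of _ "R w"])
    show "?L \<in> extensional (R w)" "?R \<in> extensional (R w)"
      using Phi_extensional w s t by auto
    fix r assume "r \<in> R w"
    then consider "r = ?a" | "r = ?b" | "r \<in> R v" using Rw by auto
    then show "?L r = ?R r"
    proof cases
      case 1
      then show ?thesis using La new Phi_old[OF w t, of ?a ?ls] Rt v by simp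
    next
      case 2
      then show ?thesis using Rb new Phi_old[OF w s, of ?b ?lt] Rs v by simp
    next
      case 3
      then show ?thesis using lt Phi_old[OF w t, of r ?ls] Phi_old[OF w s, of r ?lt] Rs Rt v by simp
    qed
  qed
qed

text \<open>The last step is by \<open>s\<close>, the one before by \<open>t\<close>. If the roots
  they add had positive product, \<open>dom\<close> and \<open>new_value_greater\<close> would give
  opposite strict inequalities. The product is \<open>- gram s t\<close>, which is nonnegative for
  \<open>s \<noteq> t\<close>, so it is 0 and the steps can be interchanged.\<close>

lemma dominating_last_root:
  assumes w: "w \<in> carrier G" and s: "s \<in> D_R w" and t: "t \<in> D_R (w \<otimes> s)"
    and k: "k \<in> C_last (w \<otimes> s) t"
    and dom: "0 < form (last_root (w \<otimes> s) t) (last_root w s) \<Longrightarrow>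
      Phi (w \<otimes> s) k s (last_root w s) < Phi (w \<otimes> s) k s (last_root (w \<otimes> s) t)"
  shows "s \<noteq> t" "s \<otimes> t = t \<otimes> s" "t \<in> D_R w" "last_root (w \<otimes> s) t = last_root w t"
    "Phi (w \<otimes> s) k s \<in> C_last w t"
proof -
  let ?r = "last_root (w \<otimes> s) t" and ?b = "last_root w s"
  have S: "s \<in> S" "t \<in> S" using s t D_R_subset_S by auto
  have ws: "w \<otimes> s \<in> carrier G" using descent_closed w s by blast
  show st: "s \<noteq> t" using s t w S S_cancel by (auto simp: D_R_def)
  have r: "?r \<in> R (w \<otimes> s)" using R_last_root(1)[OF ws t] by blast
  \<comment> \<open>Under \<open>w \<otimes> s\<close>, the first root is minus the image of the
    root of \<open>t\<close> and the second is the image of the root of \<open>s\<close>; hence the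
    single sign.\<close>
  have "form ?r ?b = - form (act (w \<otimes> s) (simple_root t)) (act (w \<otimes> s) (simple_root s))"
    using form_lincomb_left[of "-1" "act (w \<otimes> s) (simple_root t)" 0 "act (w \<otimes> s) (simple_root t)" ?b]
    by (simp add: last_root_eq ws S) (simp add: last_root_def)
  then have form: "form ?r ?b = - gram s t"
    using S gram_commute by (simp add: form_act ws form_simple_root)
  have "\<not> 0 < form ?r ?b"
  proof
    assume pos: "0 < form ?r ?b"
    then have "k ?r < new_value (R (w \<otimes> s)) k ?b"
      using new_value_greater[OF finite_R[OF ws] r] form_commute by metis
    then show False using dom[OF pos] Phi_old[OF w s r, of k] Phi_new[OF w s, of k] by simp
  qed
  then have "gram s t = 0" using form gram_nonpos S st by fastforce
  then show c: "s \<otimes> t = t \<otimes> s" using gram_eq_0_iff S st by blast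
  show tw: "t \<in> D_R w" and "last_root (w \<otimes> s) t = last_root w t"
    using commuting_descent[OF w s S(2) st c] t by auto
  obtain l where l: "l \<in> C (w \<otimes> s \<otimes> t)" "k = Phi (w \<otimes> s \<otimes> t) l t"
    using k by (auto simp: C_last_def)
  have v: "w \<otimes> s \<otimes> t = w \<otimes> t \<otimes> s" using w S S_closed c by (simp add: m_assoc)
  have "s \<in> D_R (w \<otimes> t)" using commuting_descent(1)[OF w tw S(1)] st c s by auto
  then have "Phi (w \<otimes> t \<otimes> s) l s \<in> C (w \<otimes> t)"
    using C_last_subset[OF descent_closed[OF w tw]] l v by (auto simp: C_last_def)
  then show "Phi (w \<otimes> s) k s \<in> C_last w t"
    unfolding l(2) Phi_commute[OF w s tw st c] by (auto simp: C_last_def)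
qed

text \<open>Converse to \<open>C_last_dominates\<close>. Unless \<open>r\<close> was added last, it
  stays dominating when the last step is undone, so by induction a last step by some
  \<open>t\<close> adds it there, and \<open>dominating_last_root\<close> moves that step to the
  end.\<close>

lemma ex_last_root_if_dominating:
  assumes "w \<in> carrier G" "l \<in> C w" "r \<in> R w"
    and "\<And>r'. r' \<in> R w \<Longrightarrow> r' \<noteq> r \<Longrightarrow> 0 < form r r' \<Longrightarrow> l r' < l r"
  shows "\<exists>t\<in>D_R w. r = last_root w t \<and> l \<in> C_last w t"
  using assms
proof (induction arbitrary: l rule: descent_induct)
  case one
  then show ?case by (simp add: R_one)
next
  case (descent w)
  note w = \<open>w \<in> carrier G\<close>
  obtain s where s: "s \<in> D_R w" and l: "l \<in> C_last w s"
    using descent.hyps descent.prems C_eq_UN_C_last by blast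
  show ?case
  proof (cases "r = last_root w s")
    case True
    then show ?thesis using s l by blast
  next
    case False
    then have r: "r \<in> R (w \<otimes> s)" using R_last_root(1)[OF w s] descent.prems by blast
    obtain k where k: "k \<in> C (w \<otimes> s)" "l = Phi (w \<otimes> s) k s" using l by (auto simp: C_last_def)
    have "k r' < k r" if "r' \<in> R (w \<otimes> s)" "r' \<noteq> r" "0 < form r r'" for r'
      using descent.prems(3)[of r'] that R_last_root(1)[OF w s] Phi_old[OF w s] r k by auto
    from descent.IH[OF s k(1) r this]
    obtain t where t: "t \<in> D_R (w \<otimes> s)" "r = last_root (w \<otimes> s) t" "k \<in> C_last (w \<otimes> s) t" by blast
    have "last_root w s \<in> R w" "last_root w s \<noteq> r" using R_last_root(1)[OF w s] False by auto
    then have "0 < form r (last_root w s) \<Longrightarrow> l (last_root w s) < l r" using descent.prems by blast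
    from dominating_last_root[OF w s t(1,3)] this show ?thesis unfolding t(2) k(2) by metis
  qed
qed

text \<open>The root added by \<open>t\<close> dominates on \<open>R w\<close>, hence on
  \<open>R (w \<otimes> s)\<close>, so \<open>ex_last_root_if_dominating\<close> yields a last step
  of \<open>k\<close> that adds it.\<close>

lemma C_last_Int:
  assumes w: "w \<in> carrier G" and s: "s \<in> D_R w" and t: "t \<in> D_R w" and st: "s \<noteq> t"
    and k: "k \<in> C (w \<otimes> s)" "Phi (w \<otimes> s) k s \<in> C_last w t"
  shows "s \<otimes> t = t \<otimes> s" "k \<in> C_last (w \<otimes> s) t"
proof -
  let ?l = "Phi (w \<otimes> s) k s" and ?r = "last_root w t"
  have S: "s \<in> S" "t \<in> S" using s t D_R_subset_S by auto
  have ws: "w \<otimes> s \<in> carrier G" using descent_closed w s by blast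
  have rb: "?r \<noteq> last_root w s" using last_root_inject w S st by blast
  then have r: "?r \<in> R (w \<otimes> s)" using R_last_root(1)[OF w s] R_last_root(1)[OF w t] by blast
  note dom = C_last_dominates[OF w t k(2)]
  have "k r' < k ?r" if "r' \<in> R (w \<otimes> s)" "r' \<noteq> ?r" "0 < form ?r r'" for r'
    using dom[of r'] that R_last_root(1)[OF w s] Phi_old[OF w s] r by auto
  from ex_last_root_if_dominating[OF ws k(1) r this]
  obtain t' where t': "t' \<in> D_R (w \<otimes> s)" "?r = last_root (w \<otimes> s) t'" "k \<in> C_last (w \<otimes> s) t'" by blast
  have "last_root w s \<in> R w" using R_last_root(1)[OF w s] by auto
  then have "0 < form ?r (last_root w s) \<Longrightarrow> ?l (last_root w s) < ?l ?r"
    using dom[of "last_root w s"] rb by simp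
  note d = dominating_last_root[OF w s t'(1,3), folded t'(2), OF this]
  \<comment> \<open>The generator of that step is determined by the root it adds.\<close>
  have "t' = t" using d(3,4) last_root_inject w S D_R_subset_S t'(2) by (metis subsetD)
  then show "s \<otimes> t = t \<otimes> s" "k \<in> C_last (w \<otimes> s) t" using d t' by auto
qed

subsection \<open>Inclusion-exclusion\<close>

lemma set_elem_empty: "set_elem {} = \<one>"
  by (simp add: set_elem_def finprod_def)

text \<open>The group need not be commutative, so the product is treated as a fold. Left
  multiplications by elements of an independent set commute, as \<open>LCD\<close> requires.\<close>

lemma set_elem_insert:
  assumes "independent (insert s T)" "s \<notin> T"
  shows "set_elem (insert s T) = s \<otimes> set_elem T" "set_elem T \<in> carrier G"
proof -
  have S: "insert s T \<subseteq> S" and c: "\<And>x y. x \<in> insert s T \<Longrightarrow> y \<in> insert s T \<Longrightarrow> x \<otimes> y = y \<otimes> x"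
    using assms unfolding independent_def by auto
  then have fin: "finite T" using finite_S by (meson finite_subset subset_insertI subset_trans)
  have "LCD (insert s T) (carrier G) ((\<otimes>) \<circ> (\<lambda>x. x))"
  proof
    fix x y z assume xy: "x \<in> insert s T" "y \<in> insert s T" and z: "z \<in> carrier G"
    then have "x \<in> carrier G" "y \<in> carrier G" using S S_closed by auto
    then have "x \<otimes> (y \<otimes> z) = y \<otimes> (x \<otimes> z)" using z c[OF xy] by (simp add: m_assoc[symmetric])
    then show "((\<otimes>) \<circ> (\<lambda>x. x)) x (((\<otimes>) \<circ> (\<lambda>x. x)) y z) = ((\<otimes>) \<circ> (\<lambda>x. x)) y (((\<otimes>) \<circ> (\<lambda>x. x)) x z)"
      by simp
  qed (use S S_closed in auto)
  then interpret LCD "insert s T" "carrier G" "(\<otimes>) \<circ> (\<lambda>x. x)" .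
  show "set_elem (insert s T) = s \<otimes> set_elem T"
    unfolding set_elem_def finprod_def using fin assms(2) foldD_insert[of T s \<one>] by auto
  show "set_elem T \<in> carrier G"
    unfolding set_elem_def finprod_def using fin foldD_closed[of T \<one>, OF fin one_closed subset_insertI] by simp
qed

text \<open>Undoing the step by \<open>s\<close> maps the functions common to
  \<open>insert s T\<close> bijectively to those common to \<open>T\<close> at
  \<open>w \<otimes> s\<close>. The condition \<open>l \<in> C w\<close> gives the right value for
  empty \<open>T\<close>, where the induction starts.\<close>

lemma card_common_C_last:
  assumes "finite T" "w \<in> carrier G" "T \<subseteq> D_R w" "independent T"
  shows "card {l \<in> C w. \<forall>t\<in>T. l \<in> C_last w t} = card (C (w \<otimes> set_elem T))"
  using assms
proof (induction arbitrary: w)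
  case empty
  then show ?case by (simp add: set_elem_empty)
next
  case (insert s T)
  note w = \<open>w \<in> carrier G\<close>
  have s: "s \<in> D_R w" and T: "\<And>t. t \<in> T \<Longrightarrow> t \<in> D_R w" using insert.prems by auto
  have S: "s \<in> S" using s D_R_subset_S by blast
  have ws: "w \<otimes> s \<in> carrier G" using descent_closed w s by blast
  have c: "s \<otimes> t = t \<otimes> s" "s \<noteq> t" if "t \<in> T" for t
    using insert.prems(3) insert.hyps(2) that unfolding independent_def by blast+
  have ind: "independent T" using insert.prems(3) unfolding independent_def by blast
  have Ts: "t \<in> D_R (w \<otimes> s)" if "t \<in> T" for t
    using commuting_descent(1)[OF w s subsetD[OF D_R_subset_S T[OF that]] c(2)[OF that] c(1)[OF that]]
      T[OF that] by simp
  have wT: "w \<otimes> set_elem (insert s T) = w \<otimes> s \<otimes> set_elem T"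
    using set_elem_insert[OF insert.prems(3) insert.hyps(2)] w S_closed[OF S] by (simp add: m_assoc)
  have "{l \<in> C w. \<forall>t\<in>insert s T. l \<in> C_last w t} =
      (\<lambda>k. Phi (w \<otimes> s) k s) ` {k \<in> C (w \<otimes> s). \<forall>t\<in>T. k \<in> C_last (w \<otimes> s) t}" (is "?A = ?f ` ?B")
  proof
    \<comment> \<open>By \<open>C_last_Int\<close>, the other steps remain available after
      \<open>s\<close> is undone.\<close>
    show "?A \<subseteq> ?f ` ?B"
    proof
      fix l assume l: "l \<in> ?A"
      then obtain k where k: "k \<in> C (w \<otimes> s)" "l = ?f k" by (auto simp: C_last_def)
      have "k \<in> C_last (w \<otimes> s) t" if "t \<in> T" for t
        using C_last_Int(2)[OF w s T[OF that] c(2)[OF that] k(1)] l k(2) that by simp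
      then show "l \<in> ?f ` ?B" using k by blast
    qed
    show "?f ` ?B \<subseteq> ?A"
    proof safe
      fix k assume k: "k \<in> C (w \<otimes> s)" "\<forall>t\<in>T. k \<in> C_last (w \<otimes> s) t"
      show ks: "?f k \<in> C_last w s" using k by (auto simp: C_last_def)
      then show "?f k \<in> C w" using C_last_subset w s by blast
      fix t assume t: "t \<in> T"
      have tS: "t \<in> S" using T[OF t] D_R_subset_S by blast
      \<comment> \<open>The last step of \<open>k\<close>, by \<open>t\<close>, can also be
        performed after \<open>s\<close>.\<close>
      obtain l where l: "l \<in> C (w \<otimes> s \<otimes> t)" "k = Phi (w \<otimes> s \<otimes> t) l t"
        using k(2) t by (auto simp: C_last_def)
      have v: "w \<otimes> s \<otimes> t = w \<otimes> t \<otimes> s" using w S tS S_closed c(1)[OF t] by (simp add: m_assoc)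
      have "s \<in> D_R (w \<otimes> t)"
        using commuting_descent(1)[OF w T[OF t] S] c[OF t] s by auto
      then have "Phi (w \<otimes> t \<otimes> s) l s \<in> C (w \<otimes> t)"
        using C_last_subset[OF descent_closed[OF w T[OF t]]] l v by (auto simp: C_last_def)
      then show "?f k \<in> C_last w t"
        unfolding l(2) Phi_commute[OF w s T[OF t] c(2)[OF t] c(1)[OF t]] by (auto simp: C_last_def)
    qed
  qed
  moreover have "inj_on ?f ?B" using Phi_inject[OF w s] by (auto intro!: inj_onI)
  ultimately have "card ?A = card ?B" by (simp add: card_image)
  also have "\<dots> = card (C (w \<otimes> s \<otimes> set_elem T))" using insert.IH[OF ws _ ind] Ts by blast
  finally show ?case by (simp only: wT)
qed

text \<open>\<open>C w\<close> is the union of the sets \<open>C_last w s\<close>.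
  Inclusion-exclusion gives a sum over all nonempty sets of descents, of which only the independent
  ones contribute.\<close>

lemma card_C_eq_sum:
  assumes w: "w \<in> carrier G" "w \<noteq> \<one>"
  shows "int (card (C w)) =
    (\<Sum>T | T \<noteq> {} \<and> T \<subseteq> D_R w \<and> independent T.
       (- 1) ^ (card T + 1) * int (card (C (w \<otimes> set_elem T))))"
proof -
  interpret Incl_Excl finite "\<lambda>A :: (('a \<Rightarrow> real) \<Rightarrow> nat) set. int (card A)"
    by standard (auto simp: card_Un_disjnt)
  have fin: "finite (D_R w)" using D_R_subset_S finite_S finite_subset by blast
  have "finite (C_last w s)" if "s \<in> D_R w" for s
    by (rule finite_subset[OF C_last_subset[OF w(1) that] finite_C[OF w(1)]])
  then have "int (card (C w)) =
      (\<Sum>T | T \<subseteq> D_R w \<and> T \<noteq> {}. (- 1) ^ (card T + 1) * int (card (\<Inter> (C_last w ` T))))"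
    using restricted_indexed[OF fin, of "C_last w"] C_eq_UN_C_last w by simp
  also have "\<dots> = (\<Sum>T | T \<noteq> {} \<and> T \<subseteq> D_R w \<and> independent T.
      (- 1) ^ (card T + 1) * int (card (C (w \<otimes> set_elem T))))"
  proof (rule sum.mono_neutral_cong_right)
    show "finite {T. T \<subseteq> D_R w \<and> T \<noteq> {}}" using fin by simp
    show "{T. T \<noteq> {} \<and> T \<subseteq> D_R w \<and> independent T} \<subseteq> {T. T \<subseteq> D_R w \<and> T \<noteq> {}}" by blast
    \<comment> \<open>Two elements of \<open>T\<close> that do not commute have disjoint sets
      \<open>C_last\<close>.\<close>
    show "\<forall>T\<in>{T. T \<subseteq> D_R w \<and> T \<noteq> {}} - {T. T \<noteq> {} \<and> T \<subseteq> D_R w \<and> independent T}.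
        (- 1) ^ (card T + 1) * int (card (\<Inter> (C_last w ` T))) = 0"
    proof
      fix T assume "T \<in> {T. T \<subseteq> D_R w \<and> T \<noteq> {}} - {T. T \<noteq> {} \<and> T \<subseteq> D_R w \<and> independent T}"
      then have T: "T \<subseteq> D_R w" "\<not> independent T" by auto
      then obtain s t where st: "s \<in> T" "t \<in> T" "s \<otimes> t \<noteq> t \<otimes> s"
        using D_R_subset_S unfolding independent_def by blast
      then have "s \<noteq> t" by auto
      have "C_last w s \<inter> C_last w t = {}"
      proof (rule ccontr)
        assume "C_last w s \<inter> C_last w t \<noteq> {}"
        then obtain k where "k \<in> C (w \<otimes> s)" "Phi (w \<otimes> s) k s \<in> C_last w t"
          by (auto simp: C_last_def[of w s])
        then show False using C_last_Int(1)[OF w(1) _ _ \<open>s \<noteq> t\<close>] st T by blast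
      qed
      then have "\<Inter> (C_last w ` T) = {}" using st by blast
      then show "(- 1) ^ (card T + 1) * int (card (\<Inter> (C_last w ` T))) = 0" by simp
    qed
    fix T assume "T \<in> {T. T \<noteq> {} \<and> T \<subseteq> D_R w \<and> independent T}"
    then have T: "T \<noteq> {}" "T \<subseteq> D_R w" "independent T" by auto
    then have "\<Inter> (C_last w ` T) = {l \<in> C w. \<forall>t\<in>T. l \<in> C_last w t}"
      using C_last_subset w by blast
    then show "(- 1) ^ (card T + 1) * int (card (\<Inter> (C_last w ` T))) =
        (- 1) ^ (card T + 1) * int (card (C (w \<otimes> set_elem T)))"
      using card_common_C_last[OF finite_subset[OF T(2) fin] w(1) T(2,3)] by simp
  qed
  finally show ?thesis .
qed

end

text \<open>The identity is excluded: it has no descents, so the sum would be empty, whereas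
  \<open>C \<one>\<close> has one element.\<close>

theorem theorem2p3:
  fixes G (structure) and S :: "'a set" and m :: "'a \<Rightarrow> 'a \<Rightarrow> enat" and w :: 'a
  assumes "coxeter_system G S m"
    and "finite S"
    and "w \<in> carrier G"
    and "w \<noteq> \<one>"
  shows "int (card (coxeter_system.C G S m w)) =
    (\<Sum>T | T \<noteq> {} \<and> T \<subseteq> coxeter_system.D_R G S w \<and> coxeter_system.independent G S T.
       (- 1) ^ (card T + 1) *
       int (card (coxeter_system.C G S m (w \<otimes> coxeter_system.set_elem G T))))"
proof -
  interpret finite_coxeter_system G S m
    using assms by (simp add: finite_coxeter_system_def finite_coxeter_system_axioms_def)
  show ?thesis using card_C_eq_sum assms by blast
qed

end
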